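(* Let $p\in(0,\pi)$. For $t\in(-\pi/2,\pi/2)$ put $\Omega_p(t)=e^{ip\sin t}\big(\cosh(p\cos t)-i\frac{\sinh(p\cos t)\sin t}{\cos t}\big)$, $\omega_p(t)=\frac{\sinh(p\cos t)}{\cos t}$, and $\Omega_p(\pm\pi/2)=(\cos p+p\sin p)\pm i(\sin p-p\cos p)$, $\omega_p(\pm\pi/2)=p$; let $\gamma_p(t)=e^{p\cos t+ip\sin t}$. Then: (a) For $t\in[-\pi/2,\pi/2]$ the circle $\partial\overline D(\Omega_p(t),\omega_p(t))$ is tangent to the curve $\partial\exp\overline D(0,p)$ at $\gamma_p(t)=e^{p\cos t+ip\sin t}$ and at $e^{-p\cos t+ip\sin t}$ (points that are inverse to each other with respect to the unit circle); when these coincide ($t=\pm\pi/2$) the disk is the osculating disk at $\gamma_p(t)$. The disks are orthogonal to the unit circle and pairwise distinct. (b) $\operatorname{CD}(W(p,p\sin t))=\overline D(\Omega_p(t),\omega_p(t))$, where $W(p,w)=\exp(w\tilde I)\exp(-w\tilde I+p\tilde K)$. (c) The disks $\overline D(\Omega_p(t),\omega_p(t))$, $t\in[-\pi/2,\pi/2]$, are exactly the maximal (with respect to inclusion) closed disks contained in $\exp\overline D(0,p)$, and $\overline D(\Omega_p(t),\omega_p(t))$ meets $\partial\exp\overline D(0,p)$ only at $e^{\pm p\cos t+ip\sin t}$.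
   Context: $\exp\overline D(0,p)=\{e^z: z\in\mathbb C,|z|\le p\}\subset\mathbb C$. $\tilde I=\begin{pmatrix}0&-1\\1&0\end{pmatrix}$, $\tilde J=\begin{pmatrix}1&0\\0&-1\end{pmatrix}$, $\tilde K=\begin{pmatrix}0&1\\1&0\end{pmatrix}$. For real $A=\tilde a\mathrm{Id}_2+\tilde b\tilde I+\tilde c\tilde J+\tilde d\tilde K$, the chiral disk is $\operatorname{CD}(A)=\overline D(\tilde a+\tilde b i,\sqrt{\tilde c^2+\tilde d^2})\subset\mathbb C$. *)

theory Defs
  imports "HOL-Analysis.Analysis"
begin

definition expD :: "real \<Rightarrow> complex set" where
  "expD p = {exp z | z. cmod z \<le> p}"

definition closed_disks :: "complex set set" where
  "closed_disks = {cball c r | c r. r > 0}"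

definition maximal_disk_in :: "complex set \<Rightarrow> complex set \<Rightarrow> bool" where
  "maximal_disk_in S D \<longleftrightarrow> D \<in> closed_disks \<and> D \<subseteq> S \<and>
     (\<forall>D' \<in> closed_disks. D \<subseteq> D' \<and> D' \<subseteq> S \<longrightarrow> D' = D)"

definition Omega :: "real \<Rightarrow> real \<Rightarrow> complex" where
  "Omega p t =
    (if t = pi/2 then Complex (cos p + p * sin p) (sin p - p * cos p)
     else if t = - pi/2 then Complex (cos p + p * sin p) (- (sin p - p * cos p))
     else exp (\<i> * of_real (p * sin t)) *
          (of_real (cosh (p * cos t)) - \<i> * of_real (sinh (p * cos t) * sin t / cos t)))"

definition omega :: "real \<Rightarrow> real \<Rightarrow> real" where
  "omega p t = (if t = pi/2 \<or> t = - pi/2 then p else sinh (p * cos t) / cos t)"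

(* gamma_p(s) = exp(p cos s + i p sin s); s ranging over R parametrizes the boundary curve *)
definition gamma :: "real \<Rightarrow> real \<Rightarrow> complex" where
  "gamma p s = exp (Complex (p * cos s) (p * sin s))"

definition circle_tangent_to_curve :: "complex \<Rightarrow> real \<Rightarrow> (real \<Rightarrow> complex) \<Rightarrow> real \<Rightarrow> bool" where
  "circle_tangent_to_curve c r g s \<longleftrightarrow> g s \<in> sphere c r \<and>
     (\<exists>v. (g has_vector_derivative v) (at s) \<and> v \<noteq> 0 \<and> inner v (g s - c) = 0)"

(* the disk D(c,r) is the osculating disk of the curve g at parameter s:
   centre = g + N/kappa, radius = 1/|kappa|, with signed curvature
   kappa = Im(cnj g' * g'')/|g'|^3 and unit normal N = i g'/|g'| *)
definition osculating_disk :: "complex \<Rightarrow> real \<Rightarrow> (real \<Rightarrow> complex) \<Rightarrow> real \<Rightarrow> bool" where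
  "osculating_disk c r g s \<longleftrightarrow>
     (\<exists>d1 d2 \<kappa>. (\<forall>\<^sub>F u in nhds s. (g has_vector_derivative vector_derivative g (at u)) (at u)) \<and>
        vector_derivative g (at s) = d1 \<and> d1 \<noteq> 0 \<and>
        ((\<lambda>u. vector_derivative g (at u)) has_vector_derivative d2) (at s) \<and>
        \<kappa> = Im (cnj d1 * d2) / cmod d1 ^ 3 \<and> \<kappa> \<noteq> 0 \<and>
        c = g s + \<i> * d1 / of_real (cmod d1) / of_real \<kappa> \<and> r = 1 / \<bar>\<kappa>\<bar>)"

definition orthogonal_circles :: "complex \<Rightarrow> real \<Rightarrow> complex \<Rightarrow> real \<Rightarrow> bool" where
  "orthogonal_circles c1 r1 c2 r2 \<longleftrightarrow> sphere c1 r1 \<inter> sphere c2 r2 \<noteq> {} \<and>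
     (\<forall>z \<in> sphere c1 r1 \<inter> sphere c2 r2. inner (z - c1) (z - c2) = 0)"

definition Itil :: "real^2^2" where "Itil = vector [vector [0, -1], vector [1, 0]]"
definition Jtil :: "real^2^2" where "Jtil = vector [vector [1, 0], vector [0, -1]]"
definition Ktil :: "real^2^2" where "Ktil = vector [vector [0, 1], vector [1, 0]]"

primrec mpow :: "real^2^2 \<Rightarrow> nat \<Rightarrow> real^2^2" where
  "mpow A 0 = mat 1"
| "mpow A (Suc n) = A ** mpow A n"

definition mexp :: "real^2^2 \<Rightarrow> real^2^2" where
  "mexp A = (\<Sum>n. (1 / fact n) *\<^sub>R mpow A n)"

definition W :: "real \<Rightarrow> real \<Rightarrow> real^2^2" where
  "W p w = mexp (w *\<^sub>R Itil) ** mexp ((- w) *\<^sub>R Itil + p *\<^sub>R Ktil)"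

definition CD :: "real^2^2 \<Rightarrow> complex set" where
  "CD A = (THE S. \<exists>a b c d. A = a *\<^sub>R mat 1 + b *\<^sub>R Itil + c *\<^sub>R Jtil + d *\<^sub>R Ktil \<and>
                         S = cball (Complex a b) (sqrt (c^2 + d^2)))"

end

(* In the coordinate z = exp (a + i b), and with x = p cos t, y = p sin t, the disk with parameter t
   becomes cosh a <= F(b), where F(b) = cosh x cos(b - y) - y (sinh x / x) sin(b - y), because its
   boundary is orthogonal to the unit circle. The set exp D(0,p) becomes cosh a <= h(b), |b| <= p,
   with h(b) = cosh(sqrt(p^2 - b^2)). The sinusoid F solves F'' + F = 0 and touches h to first order at
   b = y, while h'' + h > 0; a Sturm comparison yields F < h away from y. Hence the disks lie in
   exp D(0,p) and touch its boundary exactly at exp(+-x + i y). Conversely, a disk in exp D(0,p) is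
   contained in the disk of the family belonging to the boundary point nearest to its centre, so the
   members of the family, which are pairwise incomparable by their contact points, are the maximal
   disks. *)

theory Submission
  imports Defs
begin

section \<open>Power series for cosh(sqrt u) and sinh(sqrt u) / sqrt u, and a Sturm
  comparison\<close>

(* coshsq and sinhcsq are the entire functions cosh(sqrt u) and sinh(sqrt u) / sqrt u; they avoid the
   case distinctions cos t = 0 and p^2 < b^2 of the closed formulas. *)

definition coshsq :: "real \<Rightarrow> real" where
  "coshsq u = (\<Sum>n. 1 / fact (2 * n) * u ^ n)"

definition sinhcsq :: "real \<Rightarrow> real" where
  "sinhcsq u = (\<Sum>n. 1 / fact (2 * n + 1) * u ^ n)"

text \<open>The termwise derivative of \<open>sinhcsq\<close>; the series also covers u = 0, where
  the quotient (coshsq u - sinhcsq u) / (2 u) breaks down.\<close>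

definition sinhcsq' :: "real \<Rightarrow> real" where
  "sinhcsq' u = (\<Sum>n. diffs (\<lambda>n. 1 / fact (2 * n + 1)) n * u ^ n)"

text \<open>Dominated by the exponential series at |u|; needed for f n = 2 n and f n = 2 n +
  1.\<close>

lemma summable_power_over_larger_fact:
  assumes "\<And>n. n \<le> f n"
  shows "summable (\<lambda>n. 1 / fact (f n) * (u::real) ^ n)"
proof (rule summable_comparison_test)
  show "summable (\<lambda>n. inverse (fact n) * \<bar>u\<bar> ^ n)"
    by (rule summable_exp)
  have "norm (1 / fact (f n) * u ^ n) \<le> inverse (fact n) * \<bar>u\<bar> ^ n" for n
    using fact_mono[OF assms, of n, where 'a = real]
    by (auto simp: abs_mult power_abs divide_simps intro!: mult_left_mono)
  then show "\<exists>N. \<forall>n\<ge>N. norm (1 / fact (f n) * u ^ n) \<le> inverse (fact n) * \<bar>u\<bar> ^ n"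
    by blast
qed

lemma coshsq_sums: "(\<lambda>n. 1 / fact (2 * n) * u ^ n) sums coshsq u"
  unfolding coshsq_def by (intro summable_sums summable_power_over_larger_fact) simp

lemma sinhcsq_sums: "(\<lambda>n. 1 / fact (2 * n + 1) * u ^ n) sums sinhcsq u"
  unfolding sinhcsq_def by (intro summable_sums summable_power_over_larger_fact) simp

lemma sinhcsq'_sums:
  "(\<lambda>n. diffs (\<lambda>n. 1 / fact (2 * n + 1)) n * u ^ n) sums sinhcsq' u"
  unfolding sinhcsq'_def
  by (intro summable_sums termdiff_converges_all summable_power_over_larger_fact) simp

lemma coshsq_has_derivative: "(coshsq has_real_derivative sinhcsq u / 2) (at u)"
proof -
  have "diffs (\<lambda>n. 1 / fact (2 * n)) n = 1 / fact (2 * n + 1) / (2::real)" for n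
    by (simp add: diffs_def divide_simps)
  then have "(\<Sum>n. diffs (\<lambda>n. 1 / fact (2 * n)) n * u ^ n) = sinhcsq u / 2"
    using sums_unique[OF sums_divide[OF sinhcsq_sums, of u 2]] by simp
  moreover have "(coshsq has_real_derivative (\<Sum>n. diffs (\<lambda>n. 1 / fact (2 * n)) n * u ^ n)) (at u)"
    unfolding coshsq_def[abs_def]
    by (intro termdiffs_strong_converges_everywhere summable_power_over_larger_fact) simp
  ultimately show ?thesis
    by metis
qed

lemma sinhcsq_has_derivative: "(sinhcsq has_real_derivative sinhcsq' u) (at u)"
  unfolding sinhcsq_def[abs_def] sinhcsq'_def
  by (intro termdiffs_strong_converges_everywhere summable_power_over_larger_fact) simp

text \<open>Compare coefficients: 1/(2n)! - 1/(2n+1)! = 2n/(2n+1)!. The term n = 0 vanishes, which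
  permits the index shift.\<close>

lemma sinhcsq'_eq: "2 * u * sinhcsq' u = coshsq u - sinhcsq u"
proof -
  let ?f = "\<lambda>n. (1 / fact (2 * n) - 1 / fact (2 * n + 1)) * u ^ n"
  have "?f sums (coshsq u - sinhcsq u)"
    using sums_diff[OF coshsq_sums sinhcsq_sums, of u u] by (simp add: left_diff_distrib)
  then have "(\<lambda>n. ?f (Suc n)) sums (coshsq u - sinhcsq u)"
    by (subst sums_Suc_iff) simp
  moreover have "?f (Suc n) = 2 * u * (diffs (\<lambda>n. 1 / fact (2 * n + 1)) n * u ^ n)" for n
    by (simp add: diffs_def divide_simps)
  ultimately show ?thesis
    using sums_mult[OF sinhcsq'_sums, of "2 * u" u] by (simp only: sums_unique2)
qed

text \<open>The library series of cosh runs over all powers with zero odd terms, so the series of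
  \<open>coshsq\<close> is padded with zeros by \<open>sums_if\<close> before the
  comparison.\<close>

lemma coshsq_square: "coshsq (x\<^sup>2) = cosh x"
proof -
  have "(\<lambda>n. if even n then 1 / fact (2 * (n div 2)) * (x\<^sup>2) ^ (n div 2) else 0)
      sums (0 + coshsq (x\<^sup>2))"
    using sums_if[OF sums_zero coshsq_sums, of "x\<^sup>2"] by simp
  moreover have "(if even n then 1 / fact (2 * (n div 2)) * (x\<^sup>2) ^ (n div 2) else 0)
      = (if even n then x ^ n /\<^sub>R fact n else 0)" for n
    by (simp flip: power_mult add: field_simps)
  ultimately show ?thesis
    using cosh_converges[of x] by (simp add: sums_unique2)
qed

lemma sinhcsq_square: "x * sinhcsq (x\<^sup>2) = sinh x"
proof -
  have "(\<lambda>n. x * (1 / fact (2 * n + 1) * (x\<^sup>2) ^ n)) sums (x * sinhcsq (x\<^sup>2))"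
    by (intro sums_mult sinhcsq_sums)
  from sums_if'[OF this]
  have "(\<lambda>n. if even n then 0 else x * (1 / fact (2 * ((n - 1) div 2) + 1) * (x\<^sup>2) ^ ((n - 1) div 2)))
      sums (x * sinhcsq (x\<^sup>2))" .
  moreover have "(if even n then 0 else x * (1 / fact (2 * ((n - 1) div 2) + 1) * (x\<^sup>2) ^ ((n - 1) div 2)))
      = (if even n then 0 else x ^ n /\<^sub>R fact n)" for n
    by (auto simp flip: power_mult simp: field_simps elim!: oddE)
  ultimately show ?thesis
    using sinh_converges[of x] by (simp add: sums_unique2)
qed

lemma coshsq_neg_square: "coshsq (- (x\<^sup>2)) = cos x"
proof -
  have "1 / fact (2 * n) * (- (x\<^sup>2)) ^ n = (-1) ^ n / fact (2 * n) * x ^ (2 * n)" for n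
    by (simp add: power_minus[of "x\<^sup>2"] power_mult)
  then show ?thesis
    using coshsq_sums[of "- (x\<^sup>2)"] cos_paired[of x] by (simp add: sums_unique2)
qed

lemma sinhcsq_neg_square: "x * sinhcsq (- (x\<^sup>2)) = sin x"
proof -
  have "x * (1 / fact (2 * n + 1) * (- (x\<^sup>2)) ^ n) = (-1) ^ n / fact (2 * n + 1) * x ^ (2 * n + 1)" for n
    by (simp add: power_minus[of "x\<^sup>2"] power_mult)
  then show ?thesis
    using sums_mult[OF sinhcsq_sums[of "- (x\<^sup>2)"], of x] sin_paired[of x]
    by (simp only: sums_unique2)
qed

lemma sinhcsq_0 [simp]: "sinhcsq 0 = 1"
  using sums_unique2[OF sinhcsq_sums[of 0] powser_sums_zero] by simp

lemma coshsq_0 [simp]: "coshsq 0 = 1"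
  using sums_unique2[OF coshsq_sums[of 0] powser_sums_zero] by simp

lemma sinhcsq_pos: "0 < sinhcsq (x\<^sup>2)"
proof (cases "x = 0")
  case False
  then have "0 < x * sinh x"
    by (cases x "0::real" rule: linorder_cases) (simp_all add: mult_neg_neg)
  then have "0 < x\<^sup>2 * sinhcsq (x\<^sup>2)"
    by (simp flip: sinhcsq_square add: power2_eq_square mult.assoc)
  with False show ?thesis
    by (simp add: zero_less_mult_iff)
qed simp

text \<open>For u \<ge> 0 all terms are nonnegative and the constant one is positive. For u = -s^2
  with 0 < s < pi the sign is that of sin s - s cos s, which vanishes at 0 and has derivative s sin
  s.\<close>

lemma sinhcsq'_pos:
  assumes "- (pi\<^sup>2) < u"
  shows "0 < sinhcsq' u"
proof (cases "0 \<le> u")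
  case True
  then show ?thesis
    using sinhcsq'_sums[of u]
    unfolding sinhcsq'_def
    by (intro suminf_pos2[where i = 0]) (auto simp: sums_iff diffs_def)
next
  case False
  define s where "s = sqrt (- u)"
  have s: "0 < s" "s < pi" "u = - (s\<^sup>2)"
    using False assms by (auto simp: s_def intro: real_less_lsqrt)
  have "sin s - s * cos s > 0"
  proof -
    have "\<exists>z. 0 < z \<and> z < s \<and> (sin s - s * cos s) - (sin 0 - 0 * cos 0) = (s - 0) * (z * sin z)"
      by (rule MVT2) (use s in \<open>auto intro!: derivative_eq_intros\<close>)
    then obtain z where "0 < z" "z < s" "sin s - s * cos s = s * (z * sin z)"
      by auto
    then show ?thesis
      using s sin_gt_zero[of z] by simp
  qed
  then have "s * (coshsq u - sinhcsq u) < 0"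
    using sinhcsq_neg_square[of s] coshsq_neg_square[of s] s by (simp add: algebra_simps)
  then have "coshsq u - sinhcsq u < 0"
    using s by (simp add: mult_less_0_iff)
  then have "2 * u * sinhcsq' u < 0"
    unfolding sinhcsq'_eq .
  then show ?thesis
    using False by (simp add: mult_less_0_iff)
qed

(* Let h(b) = coshsq(r - b^2). The expression h'(b) sin(c - b) + h(b) cos(c - b) equals the left-hand
   side at b = y and the right-hand side at b = c, and its b-derivative is (h''(b) + h(b)) sin(c - b)
   with h''(b) + h(b) = 2 r sinhcsq'(r - b^2) > 0. *)

lemma coshsq_gt_sinusoid:
  assumes r: "r = x\<^sup>2 + y\<^sup>2" "0 < r" "r < pi\<^sup>2"
    and c: "\<bar>c\<bar> \<le> pi" "\<bar>y\<bar> \<le> pi" "c \<noteq> y" "\<bar>c - y\<bar> \<le> pi"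
  shows "cosh x * cos (c - y) - y * sinhcsq (x\<^sup>2) * sin (c - y) < coshsq (r - c\<^sup>2)"
proof -
  define E where "E b = - (b * sinhcsq (r - b\<^sup>2)) * sin (c - b) + coshsq (r - b\<^sup>2) * cos (c - b)" for b
  define E' where "E' b = 2 * r * sinhcsq' (r - b\<^sup>2) * sin (c - b)" for b
  have E': "(E has_real_derivative E' b) (at b)" for b
  proof -
    have "(E has_real_derivative
        (2 * b\<^sup>2 * sinhcsq' (r - b\<^sup>2) + (coshsq (r - b\<^sup>2) - sinhcsq (r - b\<^sup>2))) * sin (c - b)) (at b)"
      unfolding E_def
      by (rule derivative_eq_intros DERIV_chain2[OF coshsq_has_derivative]
          DERIV_chain2[OF sinhcsq_has_derivative] refl | simp)+
        (simp add: algebra_simps power2_eq_square)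
    then show ?thesis
      unfolding sinhcsq'_eq[symmetric] by (simp add: E'_def algebra_simps)
  qed
  \<comment> \<open>Here r > 0 puts r - b^2 strictly above -pi^2, even for |b| = pi.\<close>
  have pos: "0 < sinhcsq' (r - b\<^sup>2)" if "\<bar>b\<bar> \<le> pi" for b
    using that r abs_le_square_iff[of b pi] by (intro sinhcsq'_pos) simp
  have "E y < E c"
  proof (cases "y < c")
    case True
    with MVT2[of y c E E'] E' obtain z where z: "y < z" "z < c" "E c - E y = (c - y) * E' z"
      by blast
    have "0 < (c - y) * E' z"
      unfolding E'_def using z c r by (intro mult_pos_pos pos sin_gt_zero) auto
    with z show ?thesis by simp
  next
    case False
    with MVT2[of c y E E'] E' c obtain z where z: "c < z" "z < y" "E y - E c = (y - c) * E' z"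
      by (meson linorder_neqE_linordered_idom)
    have "0 < 2 * r * sinhcsq' (r - z\<^sup>2) * sin (z - c)"
      using z c r by (intro mult_pos_pos pos sin_gt_zero) auto
    then have "E' z < 0"
      unfolding E'_def using sin_minus[of "z - c"] by simp
    with z show ?thesis
      by (smt (verit) mult_pos_neg)
  qed
  then show ?thesis
    by (simp add: E_def r coshsq_square)
qed

section \<open>Exponentials of real 2 by 2 matrices\<close>

lemma mpow_even_odd:
  assumes "A ** A = q *\<^sub>R mat 1"
  shows "mpow A (2 * n) = q ^ n *\<^sub>R mat 1 \<and> mpow A (2 * n + 1) = q ^ n *\<^sub>R A"
proof (induction n)
  case (Suc n)
  have [simp]: "A ** (k *\<^sub>R B) = k *\<^sub>R (A ** B)" for k and B :: "real^2^2"
    by (simp add: matrix_matrix_mult_def vec_eq_iff sum_distrib_left mult.left_commute)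
  from Suc assms show ?case
    by (simp add: mult.commute)
qed simp

text \<open>The powers of A alternate between multiples of Id and of A, so the exponential series
  splits by parity. Both exponents in \<open>W\<close> square to scalars, since \<open>Itil\<close>
  and \<open>Ktil\<close> anticommute.\<close>

lemma mexp_square_scalar:
  assumes "A ** A = q *\<^sub>R mat 1"
  shows "mexp A = coshsq q *\<^sub>R mat 1 + sinhcsq q *\<^sub>R A"
proof -
  have ev: "(\<lambda>n. if even n then 1 / fact (2 * (n div 2)) * q ^ (n div 2) else 0) sums (0 + coshsq q)"
    using sums_if[OF sums_zero coshsq_sums, of q] by simp
  have od: "(\<lambda>n. if even n then 0 else 1 / fact (2 * ((n - 1) div 2) + 1) * q ^ ((n - 1) div 2))
      sums sinhcsq q"
    using sums_if'[OF sinhcsq_sums, of q] .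
  have eq: "(1 / fact n) *\<^sub>R mpow A n
      = (if even n then 1 / fact (2 * (n div 2)) * q ^ (n div 2) else 0) *\<^sub>R mat 1
      + (if even n then 0 else 1 / fact (2 * ((n - 1) div 2) + 1) * q ^ ((n - 1) div 2)) *\<^sub>R A" for n
  proof (cases "even n")
    case True
    then obtain k where "n = 2 * k" by blast
    then show ?thesis using mpow_even_odd[OF assms, of k] by simp
  next
    case False
    then obtain k where "n = 2 * k + 1" by (auto elim: oddE)
    then show ?thesis using mpow_even_odd[OF assms, of k] by (simp del: mpow.simps)
  qed
  have "(\<lambda>n. (1 / fact n) *\<^sub>R mpow A n) sums (coshsq q *\<^sub>R mat 1 + sinhcsq q *\<^sub>R A)"
    unfolding eq
    using sums_add[OF bounded_linear.sums[OF bounded_linear_scaleR_left ev]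
        bounded_linear.sums[OF bounded_linear_scaleR_left od]] by simp
  then show ?thesis
    unfolding mexp_def by (rule sums_unique[symmetric])
qed

lemmas tilde_matrix_simps = matrix_matrix_mult_def vec_eq_iff forall_2 sum_2
  Itil_def Jtil_def Ktil_def mat_def

lemma mexp_Itil: "mexp (w *\<^sub>R Itil) = cos w *\<^sub>R mat 1 + sin w *\<^sub>R Itil"
proof -
  have "mexp (w *\<^sub>R Itil) = coshsq (- (w\<^sup>2)) *\<^sub>R mat 1 + sinhcsq (- (w\<^sup>2)) *\<^sub>R (w *\<^sub>R Itil)"
    by (rule mexp_square_scalar) (simp add: tilde_matrix_simps power2_eq_square)
  then show ?thesis
    by (simp add: coshsq_neg_square mult.commute[of _ w] sinhcsq_neg_square)
qed

lemma mexp_Itil_Ktil: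
  "mexp ((- w) *\<^sub>R Itil + p *\<^sub>R Ktil)
    = coshsq (p\<^sup>2 - w\<^sup>2) *\<^sub>R mat 1 + sinhcsq (p\<^sup>2 - w\<^sup>2) *\<^sub>R ((- w) *\<^sub>R Itil + p *\<^sub>R Ktil)"
  by (rule mexp_square_scalar) (simp add: tilde_matrix_simps power2_eq_square algebra_simps)

text \<open>The definite description in \<open>CD\<close> is justified because Id, I, J, K are
  linearly independent: the four entries determine the coordinates.\<close>

lemma CD_eq:
  "CD (a *\<^sub>R mat 1 + b *\<^sub>R Itil + c *\<^sub>R Jtil + d *\<^sub>R Ktil) = cball (Complex a b) (sqrt (c\<^sup>2 + d\<^sup>2))"
  unfolding CD_def
proof (rule the_equality)
  fix S
  assume "\<exists>a' b' c' d'. a *\<^sub>R mat 1 + b *\<^sub>R Itil + c *\<^sub>R Jtil + d *\<^sub>R Ktil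
      = a' *\<^sub>R mat 1 + b' *\<^sub>R Itil + c' *\<^sub>R Jtil + d' *\<^sub>R Ktil
      \<and> S = cball (Complex a' b') (sqrt (c'\<^sup>2 + d'\<^sup>2))"
  then obtain a' b' c' d' where
    "a + c = a' + c'" "d - b = d' - b'" "b + d = b' + d'" "a - c = a' - c'"
    and S: "S = cball (Complex a' b') (sqrt (c'\<^sup>2 + d'\<^sup>2))"
    by (auto simp: tilde_matrix_simps)
  then have "a = a'" "b = b'" "c = c'" "d = d'"
    by linarith+
  with S show "S = cball (Complex a b) (sqrt (c\<^sup>2 + d\<^sup>2))"
    by simp
qed (rule exI[of _ a], rule exI[of _ b], rule exI[of _ c], rule exI[of _ d], simp)

section \<open>The disks in logarithmic coordinates\<close>

text \<open>With f(s) = A cos s + B sin s, the identity f(\<alpha>) sin(\<alpha> + \<beta>) =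
  f(\<alpha> + \<beta>) sin \<alpha> + f(0) sin \<beta> combines with sin(\<alpha> + \<beta>) \<le>
  sin \<alpha> + sin \<beta>: bounds at both ends of an arc shorter than pi pass to its
  interior.\<close>

lemma sinusoid_ge_one:
  fixes A B \<alpha> \<beta> :: real
  assumes "1 \<le> A" "1 \<le> A * cos (\<alpha> + \<beta>) + B * sin (\<alpha> + \<beta>)"
    and "0 \<le> \<alpha>" "0 \<le> \<beta>" "0 < \<alpha> + \<beta>" "\<alpha> + \<beta> < pi"
  shows "1 \<le> A * cos \<alpha> + B * sin \<alpha>"
proof -
  have s: "0 \<le> sin \<alpha>" "0 \<le> sin \<beta>" "0 < sin (\<alpha> + \<beta>)"
    using assms by (auto intro: sin_ge_zero sin_gt_zero)
  have "sin (\<alpha> + \<beta>) \<le> sin \<alpha> + sin \<beta>"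
    unfolding sin_add using s mult_left_le[of "cos \<beta>" "sin \<alpha>"] mult_left_le[of "cos \<alpha>" "sin \<beta>"]
    by (simp add: mult.commute)
  also have "\<dots> \<le> (A * cos (\<alpha> + \<beta>) + B * sin (\<alpha> + \<beta>)) * sin \<alpha> + A * sin \<beta>"
    using mult_right_mono[OF assms(2) s(1)] mult_right_mono[OF assms(1) s(2)] by simp
  also have "A * sin \<beta> = A * (sin (\<alpha> + \<beta>) * cos \<alpha> - cos (\<alpha> + \<beta>) * sin \<alpha>)"
    using sin_diff[of "\<alpha> + \<beta>" \<alpha>] by simp
  finally have "1 * sin (\<alpha> + \<beta>) \<le> (A * cos \<alpha> + B * sin \<alpha>) * sin (\<alpha> + \<beta>)"
    by (simp add: algebra_simps)
  then show ?thesis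
    by (rule mult_right_le_imp_le) (rule s)
qed

lemma cosh_le_cosh_iff: "cosh u \<le> cosh v \<longleftrightarrow> u\<^sup>2 \<le> v\<^sup>2" for u v :: real
proof -
  have "cosh \<bar>w\<bar> = cosh w" for w :: real
    by (simp add: abs_if)
  then show ?thesis
    using cosh_real_nonneg_le_iff[of "\<bar>u\<bar>" "\<bar>v\<bar>"] by (simp add: abs_le_square_iff)
qed

text \<open>For |b - y| \<le> pi this is the Sturm comparison; since cosh a \<ge> 1, it forces b^2 <
  p^2, where the bound is an honest cosh(sqrt(p^2 - b^2)). A larger |b - y| is impossible, as the
  disk would then reach across the negative real axis.\<close>

lemma log_disk_in_disk:
  assumes xy: "x\<^sup>2 + y\<^sup>2 = p\<^sup>2" and p: "0 < p" "p < pi"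
    and b: "- pi < b" "b \<le> pi"
    and le: "cosh a \<le> cosh x * cos (b - y) - y * sinhcsq (x\<^sup>2) * sin (b - y)"
  shows "b = y \<and> a\<^sup>2 \<le> x\<^sup>2 \<or> a\<^sup>2 + b\<^sup>2 < p\<^sup>2"
proof -
  have "\<bar>y\<bar> \<le> \<bar>p\<bar>"
    using xy by (subst abs_le_square_iff) (smt (verit) zero_le_power2)
  then have y: "\<bar>y\<bar> \<le> p" "\<bar>y\<bar> \<le> pi" using p by auto
  have r: "p\<^sup>2 = x\<^sup>2 + y\<^sup>2" "0 < p\<^sup>2" "p\<^sup>2 < pi\<^sup>2"
    using xy p by (auto intro: power_strict_mono)
  note gt = coshsq_gt_sinusoid[OF r]
  have coshsq_le_1: "coshsq (p\<^sup>2 - c\<^sup>2) \<le> 1" if "p\<^sup>2 \<le> c\<^sup>2" for c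
    using coshsq_neg_square[of "sqrt (c\<^sup>2 - p\<^sup>2)"] that by simp
  have one: "1 \<le> cosh x * cos (b - y) - y * sinhcsq (x\<^sup>2) * sin (b - y)"
    using le cosh_real_ge_1[of a] by linarith
  consider "b = y" | "b \<noteq> y" "\<bar>b - y\<bar> \<le> pi" | "b - y > pi" | "y - b > pi"
    by linarith
  then show ?thesis
  proof cases
    case 1
    with le show ?thesis by (simp add: cosh_le_cosh_iff)
  next
    case 2
    moreover have "\<bar>b\<bar> \<le> pi" using b by linarith
    ultimately have lt: "cosh a < coshsq (p\<^sup>2 - b\<^sup>2)"
      using gt[of b] b y le by auto
    then have "b\<^sup>2 < p\<^sup>2"
      using coshsq_le_1[of b] cosh_real_ge_1[of a] by linarith
    then have "cosh a < cosh (sqrt (p\<^sup>2 - b\<^sup>2))"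
      using lt by (simp flip: coshsq_square)
    then have "a\<^sup>2 < (sqrt (p\<^sup>2 - b\<^sup>2))\<^sup>2"
      by (simp flip: not_le add: cosh_le_cosh_iff)
    with \<open>b\<^sup>2 < p\<^sup>2\<close> show ?thesis by simp
  next
    \<comment> \<open>The angle b - 2 pi has the same direction as b and lies below y by s < pi. The
      arc from y down to it passes -pi, so the sinusoid is at least 1 there, against the comparison
      at c = -pi.\<close>
    case 3
    define s where "s = (pi + y) + (pi - b)"
    have "b - y = 2 * pi - s" by (simp add: s_def)
    then have "1 \<le> cosh x * cos s + y * sinhcsq (x\<^sup>2) * sin s"
      using one by (simp only: cos_2pi_minus sin_2pi_minus mult_minus_right diff_minus_eq_add)
    then have "1 \<le> cosh x * cos (pi + y) + y * sinhcsq (x\<^sup>2) * sin (pi + y)"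
      using 3 b y p unfolding s_def by - (rule sinusoid_ge_one[OF cosh_real_ge_1, of x "pi + y" "pi - b"], linarith+)
    moreover have "- pi - y = - (pi + y)" by simp
    moreover have "cosh x * cos (- pi - y) - y * sinhcsq (x\<^sup>2) * sin (- pi - y) < coshsq (p\<^sup>2 - (- pi)\<^sup>2)"
      using 3 b y p by (intro gt) linarith+
    ultimately have "1 < coshsq (p\<^sup>2 - (- pi)\<^sup>2)"
      by (simp only: cos_minus sin_minus mult_minus_right)
    with coshsq_le_1[of "- pi"] r show ?thesis by simp
  next
    \<comment> \<open>The mirror image: the arc from y up to b + 2 pi passes pi.\<close>
    case 4
    define s where "s = (pi - y) + (pi + b)"
    have "y - b = 2 * pi - s" by (simp add: s_def)
    moreover note cos_minus[of "y - b", unfolded minus_diff_eq] sin_minus[of "y - b", unfolded minus_diff_eq]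
    ultimately have "1 \<le> cosh x * cos s + (- (y * sinhcsq (x\<^sup>2))) * sin s"
      using one by (simp only: cos_2pi_minus sin_2pi_minus minus_minus mult_minus_left flip: diff_conv_add_uminus)
    then have "1 \<le> cosh x * cos (pi - y) + (- (y * sinhcsq (x\<^sup>2))) * sin (pi - y)"
      using 4 b y p unfolding s_def by - (rule sinusoid_ge_one[OF cosh_real_ge_1, of x "pi - y" "pi + b"], linarith+)
    moreover have "cosh x * cos (pi - y) - y * sinhcsq (x\<^sup>2) * sin (pi - y) < coshsq (p\<^sup>2 - pi\<^sup>2)"
      using 4 b y p by (intro gt) linarith+
    ultimately have "1 < coshsq (p\<^sup>2 - pi\<^sup>2)"
      by (simp only: mult_minus_left flip: diff_conv_add_uminus)
    with coshsq_le_1[of pi] r show ?thesis by simp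
  qed
qed

text \<open>The centre \<open>Omega\<close> in the coordinates x = p cos t, y = p sin t, with
  \<open>sinhcsq\<close> filling in sinh x / x at x = 0.\<close>

definition disk_centre :: "real \<Rightarrow> real \<Rightarrow> complex" where
  "disk_centre x y = cis y * Complex (cosh x) (- (y * sinhcsq (x\<^sup>2)))"

definition disk_radius :: "real \<Rightarrow> real \<Rightarrow> real" where
  "disk_radius x y = cmod (Complex x y) * sinhcsq (x\<^sup>2)"

lemma exp_Complex: "exp (Complex a b) = of_real (exp a) * cis b"
  by (simp add: exp_eq_polar)

text \<open>After rotating by -y, expand the square. The hypothesis says that the circle with centre
  A + i B and radius R is orthogonal to the unit circle; it supplies the 1 in exp(2a) + 1 = 2 exp(a)
  cosh(a).\<close>

lemma norm_exp_diff:
  assumes "A\<^sup>2 + B\<^sup>2 = 1 + R\<^sup>2"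
  shows "(cmod (exp (Complex a b) - cis y * Complex A B))\<^sup>2
    = R\<^sup>2 + 2 * exp a * (cosh a - (A * cos (b - y) + B * sin (b - y)))"
proof -
  have "exp (Complex a b) - cis y * Complex A B = cis y * (of_real (exp a) * cis (b - y) - Complex A B)"
    by (simp add: exp_Complex right_diff_distrib cis_mult mult.left_commute)
  then have "(cmod (exp (Complex a b) - cis y * Complex A B))\<^sup>2
      = (exp a * cos (b - y) - A)\<^sup>2 + (exp a * sin (b - y) - B)\<^sup>2"
    by (simp add: norm_mult cmod_power2)
  also have "\<dots> = (exp a)\<^sup>2 * ((cos (b - y))\<^sup>2 + (sin (b - y))\<^sup>2) + (A\<^sup>2 + B\<^sup>2)
      - 2 * exp a * (A * cos (b - y) + B * sin (b - y))"
    by (simp only: power2_eq_square) (simp only: algebra_simps)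
  also have "\<dots> = (exp a)\<^sup>2 + 1 + R\<^sup>2 - 2 * exp a * (A * cos (b - y) + B * sin (b - y))"
    using assms by simp
  also have "(exp a)\<^sup>2 + 1 = 2 * exp a * cosh a"
    by (simp add: cosh_def power2_eq_square exp_minus field_simps)
  finally show ?thesis
    by (simp add: algebra_simps)
qed

lemma disk_radius_nonneg: "0 \<le> disk_radius x y"
  by (simp add: disk_radius_def less_imp_le[OF sinhcsq_pos])

lemma disk_centre_norm: "(cosh x)\<^sup>2 + (- (y * sinhcsq (x\<^sup>2)))\<^sup>2 = 1 + (disk_radius x y)\<^sup>2"
  by (simp add: disk_radius_def cosh_square_eq cmod_power2 power_mult_distrib distrib_right
      flip: sinhcsq_square[of x])

lemma norm_disk_centre: "(cmod (disk_centre x y))\<^sup>2 = 1 + (disk_radius x y)\<^sup>2"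
  using disk_centre_norm[of x y] by (simp add: disk_centre_def norm_mult cmod_power2)

lemma exp_in_disk_iff:
  "exp (Complex a b) \<in> cball (disk_centre x y) (disk_radius x y)
    \<longleftrightarrow> cosh a \<le> cosh x * cos (b - y) - y * sinhcsq (x\<^sup>2) * sin (b - y)"
proof -
  have "exp (Complex a b) \<in> cball (disk_centre x y) (disk_radius x y)
      \<longleftrightarrow> (cmod (exp (Complex a b) - disk_centre x y))\<^sup>2 \<le> (disk_radius x y)\<^sup>2"
    by (simp add: dist_norm norm_minus_commute disk_radius_nonneg flip: abs_le_square_iff)
  also have "\<dots> \<longleftrightarrow> cosh a \<le> cosh x * cos (b - y) - y * sinhcsq (x\<^sup>2) * sin (b - y)"
    unfolding disk_centre_def norm_exp_diff[OF disk_centre_norm]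
    by (simp add: mult_le_0_iff)
  finally show ?thesis .
qed

text \<open>The normal direction at the contact point, used both for tangency and for placing the
  centres of contained disks on one line.\<close>

lemma exp_minus_disk_centre:
  "exp (Complex x y) - disk_centre x y = of_real (sinhcsq (x\<^sup>2)) * cis y * Complex x y"
proof -
  have "exp (Complex x y) - disk_centre x y
      = cis y * Complex (exp x - cosh x) (y * sinhcsq (x\<^sup>2))"
    by (simp add: disk_centre_def exp_Complex complex_eq_iff algebra_simps)
  also have "exp x - cosh x = x * sinhcsq (x\<^sup>2)"
    unfolding sinhcsq_square using cosh_plus_sinh[of x] by linarith
  also have "Complex (x * sinhcsq (x\<^sup>2)) (y * sinhcsq (x\<^sup>2)) = of_real (sinhcsq (x\<^sup>2)) * Complex x y"
    by (simp add: complex_eq_iff)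
  finally show ?thesis
    by (simp add: mult_ac)
qed

section \<open>The set exp D(0,p), its frontier, and its contact with the disks\<close>

lemma expD_eq: "expD p = exp ` cball 0 p"
  by (auto simp: expD_def)

lemma closed_expD: "closed (expD p)"
  unfolding expD_eq by (intro compact_imp_closed compact_continuous_image continuous_intros) auto

lemma exp_in_expD_iff:
  assumes "p < pi" "cmod w < pi"
  shows "exp w \<in> expD p \<longleftrightarrow> cmod w \<le> p"
proof
  assume "exp w \<in> expD p"
  then obtain v where "exp w = exp v" "cmod v \<le> p" by (auto simp: expD_def)
  with assms inj_onD[OF inj_on_exp_pi[of 0], of w v] show "cmod w \<le> p" by auto
qed (auto simp: expD_def)

text \<open>Since exp is injective on the ball of radius pi, invariance of domain makes exp of the
  open p-ball open. Conversely, pulling the interior back into the pi-ball gives an open subset of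
  \<open>cball 0 p\<close>, which misses the sphere.\<close>

lemma frontier_expD:
  assumes "p < pi"
  shows "frontier (expD p) = exp ` sphere 0 p"
proof -
  have "exp ` ball 0 p \<subseteq> interior (expD p)"
  proof (rule interior_maximal)
    have "ball 0 p \<subseteq> ball (0 :: complex) pi"
      using assms by (intro subset_ball) simp
    then show "open (exp ` ball 0 p :: complex set)"
      by (intro invariance_of_domain continuous_on_exp continuous_on_id open_ball
          inj_on_subset[OF inj_on_exp_pi])
    show "exp ` ball 0 p \<subseteq> expD p"
      unfolding expD_eq by (rule image_mono[OF ball_subset_cball])
  qed
  moreover have "exp w \<notin> interior (expD p)" if "cmod w = p" for w
  proof
    assume w: "exp w \<in> interior (expD p)"
    have "open (exp -` interior (expD p) \<inter> ball 0 pi)"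
      by (intro open_Int open_vimage open_interior open_ball continuous_on_exp continuous_on_id)
    moreover have "exp -` interior (expD p) \<inter> ball 0 pi \<subseteq> cball 0 p"
    proof
      fix v :: complex assume "v \<in> exp -` interior (expD p) \<inter> ball 0 pi"
      then have "exp v \<in> expD p" "cmod v < pi"
        using interior_subset[of "expD p"] by auto
      then show "v \<in> cball 0 p"
        using exp_in_expD_iff[OF assms] by simp
    qed
    ultimately have "exp -` interior (expD p) \<inter> ball 0 pi \<subseteq> interior (cball 0 p)"
      by (intro interior_maximal)
    moreover have "w \<in> exp -` interior (expD p) \<inter> ball 0 pi"
      using w that assms by simp
    ultimately have "w \<in> ball 0 p"
      unfolding interior_cball by (rule subsetD)
    with that show False by simp
  qed
  moreover have "frontier (expD p) = exp ` cball 0 p - interior (expD p)"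
    using closed_expD[of p] by (simp add: frontier_def expD_eq)
  moreover have "cball 0 p = ball 0 p \<union> sphere (0 :: complex) p"
    by auto
  ultimately show ?thesis
    by auto
qed

lemma disk_subset_expD:
  assumes xy: "x\<^sup>2 + y\<^sup>2 = p\<^sup>2" and p: "0 < p" "p < pi"
  shows "cball (disk_centre x y) (disk_radius x y) \<subseteq> expD p"
proof
  fix z assume z: "z \<in> cball (disk_centre x y) (disk_radius x y)"
  \<comment> \<open>The disk avoids 0 because |c|^2 = 1 + r^2 > r^2, so the principal logarithm
    applies, with imaginary part in the range that \<open>log_disk_in_disk\<close> requires.\<close>
  have "z \<noteq> 0"
  proof
    assume "z = 0"
    with z have "(cmod (disk_centre x y))\<^sup>2 \<le> (disk_radius x y)\<^sup>2"
      by (intro power_mono) auto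
    then show False by (simp add: norm_disk_centre)
  qed
  then have eq: "exp (Complex (Re (Ln z)) (Im (Ln z))) = z"
    unfolding complex_surj by (rule exp_Ln)
  have "(Re (Ln z))\<^sup>2 + (Im (Ln z))\<^sup>2 \<le> p\<^sup>2"
    using log_disk_in_disk[OF xy p mpi_less_Im_Ln[OF \<open>z \<noteq> 0\<close>] Im_Ln_le_pi[OF \<open>z \<noteq> 0\<close>],
        of "Re (Ln z)"] z exp_in_disk_iff[of "Re (Ln z)" "Im (Ln z)" x y] xy
    unfolding eq by auto
  then have "cmod (Ln z) \<le> p"
    using p by (simp flip: cmod_power2 abs_le_square_iff)
  then show "z \<in> expD p"
    using \<open>z \<noteq> 0\<close> unfolding expD_def by (auto intro!: exI[of _ "Ln z"])
qed

text \<open>On the frontier a^2 + b^2 = p^2 rules out the strict alternative of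
  \<open>log_disk_in_disk\<close>, leaving b = y and a^2 = x^2.\<close>

lemma disk_Int_frontier:
  assumes xy: "x\<^sup>2 + y\<^sup>2 = p\<^sup>2" and p: "0 < p" "p < pi"
  shows "cball (disk_centre x y) (disk_radius x y) \<inter> frontier (expD p)
    = {exp (Complex x y), exp (Complex (- x) y)}"
proof -
  have norm_iff: "cmod (Complex a b) = p \<longleftrightarrow> a\<^sup>2 + b\<^sup>2 = p\<^sup>2" for a b
    using p by (auto simp: cmod_def real_sqrt_unique)
  have "w = Complex x y \<or> w = Complex (- x) y"
    if "exp w \<in> cball (disk_centre x y) (disk_radius x y)" "cmod w = p" for w
  proof -
    obtain a b where w: "w = Complex a b" by (cases w)
    have ab: "a\<^sup>2 + b\<^sup>2 = p\<^sup>2" using that(2) norm_iff w by simp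
    have "\<bar>b\<bar> \<le> p" using that(2) abs_Im_le_cmod[of w] w by simp
    then have "b = y \<and> a\<^sup>2 \<le> x\<^sup>2 \<or> a\<^sup>2 + b\<^sup>2 < p\<^sup>2"
      using that(1) p unfolding w exp_in_disk_iff by (intro log_disk_in_disk[OF xy p]) auto
    then have "b = y" using ab by simp
    with ab xy have "a\<^sup>2 = x\<^sup>2" by simp
    with \<open>b = y\<close> show ?thesis
      unfolding w by (auto simp: power2_eq_iff)
  qed
  moreover have "exp (Complex x y) \<in> cball (disk_centre x y) (disk_radius x y)"
    "exp (Complex (- x) y) \<in> cball (disk_centre x y) (disk_radius x y)"
    unfolding exp_in_disk_iff by simp_all
  moreover have "cmod (Complex x y) = p" "cmod (Complex (- x) y) = p"
    using xy norm_iff by simp_all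
  ultimately show ?thesis
    unfolding frontier_expD[OF p(2)]
    by (intro equalityI subsetI) (force simp del: mem_cball, auto simp del: mem_cball)
qed

section \<open>Disks contained in the image of the exponential\<close>

lemma norm_diff_squared_has_derivative:
  fixes f :: "real \<Rightarrow> 'a::real_inner"
  assumes "(f has_vector_derivative v) (at s)"
  shows "((\<lambda>u. (norm (f u - c))\<^sup>2) has_real_derivative 2 * inner v (f s - c)) (at s)"
  unfolding power2_norm_eq_inner has_field_derivative_def
  using assms unfolding has_vector_derivative_def
  by (auto intro!: derivative_eq_intros simp: inner_commute algebra_simps)

text \<open>A nearest frontier point exists since the frontier is closed and nonempty. Minimality
  extends to the outer annulus, because a segment from c to a point outside crosses the frontier;
  this permits radial variation.\<close>

lemma nearest_frontier_expD:
  assumes p: "p < pi" and sub: "cball c r \<subseteq> expD p" and r: "0 < r"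
  obtains w where "cmod w = p" "r \<le> cmod (exp w - c)"
    "\<And>v. p \<le> cmod v \<Longrightarrow> cmod v < pi \<Longrightarrow> cmod (exp w - c) \<le> cmod (exp v - c)"
proof -
  have c: "c \<in> expD p" using sub r by auto
  then have "0 \<le> p" unfolding expD_def using order.trans[OF norm_ge_zero] by blast
  then have "frontier (expD p) \<noteq> {}" by (simp add: frontier_expD[OF p])
  then obtain P where P: "P \<in> frontier (expD p)" "\<And>q. q \<in> frontier (expD p) \<Longrightarrow> dist c P \<le> dist c q"
    using distance_attains_inf[OF frontier_closed] by blast
  then obtain w where w: "cmod w = p" "P = exp w"
    unfolding frontier_expD[OF p] by auto
  have "P \<notin> ball c r"
  proof
    assume "P \<in> ball c r"
    then have "P \<in> interior (expD p)"
      using interior_mono[OF sub] by auto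
    with P(1) show False by (simp add: frontier_def)
  qed
  moreover have "dist c P \<le> dist c (exp v)" if v: "p \<le> cmod v" "cmod v < pi" for v
  proof (cases "cmod v = p")
    case True
    then show ?thesis
      using P(2) unfolding frontier_expD[OF p] by auto
  next
    case False
    then have "exp v \<notin> expD p" using exp_in_expD_iff[OF p v(2)] v by simp
    then have "closed_segment c (exp v) \<inter> frontier (expD p) \<noteq> {}"
      using c by (intro connected_Int_frontier) auto
    then obtain q where q: "q \<in> closed_segment c (exp v)" "q \<in> frontier (expD p)"
      by blast
    with dist_in_closed_segment[OF q(1)] P(2)[OF q(2)] show ?thesis
      by (simp add: dist_commute)
  qed
  ultimately show ?thesis
    using w by (intro that[of w]) (auto simp: dist_norm norm_minus_commute)
qed

(* At the frontier point P = exp w nearest to c, criticality along the frontier and in the radial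
   direction gives c = P - nu * cis b * w with nu >= 0, whereas disk_centre a b = P - K * cis b * w.
   It remains to show nu <= K: test the minimality of P against the second contact point
   exp(-a + i b), or, if a = 0, against frontier points close to P. *)

lemma disk_subset_tangent_disk:
  assumes p: "0 < p" "p < pi" and sub: "cball c r \<subseteq> expD p" and r: "0 < r"
  obtains x y where "x\<^sup>2 + y\<^sup>2 = p\<^sup>2" "cball c r \<subseteq> cball (disk_centre x y) (disk_radius x y)"
proof -
  obtain w where w: "cmod w = p" "r \<le> cmod (exp w - c)"
    and near: "\<And>v. p \<le> cmod v \<Longrightarrow> cmod v < pi \<Longrightarrow> cmod (exp w - c) \<le> cmod (exp v - c)"
    using nearest_frontier_expD[OF p(2) sub r] by metis
  obtain a b where ab: "w = Complex a b" by (cases w)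
  define u where "u = exp w - c"
  define K where "K = sinhcsq (a\<^sup>2)"
  have ab_p: "a\<^sup>2 + b\<^sup>2 = p\<^sup>2" using w(1) ab cmod_power2[of w] by simp
  have exp_w: "exp w = of_real (exp a) * cis b" by (simp add: ab exp_Complex)
  have Im0: "inner (\<i> * w * exp w) u = 0"
  proof -
    have "((\<lambda>\<theta>. exp (cis \<theta> * w)) has_vector_derivative (\<i> * w * exp w)) (at 0)"
      unfolding cis_conv_exp
      by (rule has_vector_derivative_real_field[where f = "\<lambda>z. exp (exp (\<i> * z) * w)"])
        (auto intro!: derivative_eq_intros)
    from norm_diff_squared_has_derivative[OF this, of c]
    have "2 * inner (\<i> * w * exp w) (exp (cis 0 * w) - c) = 0"
    proof (rule DERIV_local_min)
      show "\<forall>\<theta>. \<bar>0 - \<theta>\<bar> < 1 \<longrightarrow> (cmod (exp (cis 0 * w) - c))\<^sup>2 \<le> (cmod (exp (cis \<theta> * w) - c))\<^sup>2"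
        using near w(1) p by (auto intro!: power_mono simp: norm_mult)
    qed simp
    then show ?thesis by (simp add: u_def)
  qed
  have pos: "0 \<le> inner (w * exp w) u"
  proof (rule ccontr)
    assume neg: "\<not> ?thesis"
    have "((\<lambda>\<rho>. exp (of_real (1 + \<rho>) * w)) has_vector_derivative (w * exp w)) (at 0)"
      unfolding of_real_add
      by (rule has_vector_derivative_real_field[where f = "\<lambda>z. exp ((of_real 1 + z) * w)"])
        (auto intro!: derivative_eq_intros)
    from DERIV_neg_dec_right[OF norm_diff_squared_has_derivative[OF this, of c]] neg
    obtain d where d: "0 < d"
      "\<And>h. 0 < h \<Longrightarrow> h < d \<Longrightarrow> (cmod (exp (of_real (1 + h) * w) - c))\<^sup>2 < (cmod u)\<^sup>2"
      by (auto simp: u_def)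
    \<comment> \<open>Small enough for the decrease found above and for (1 + h) p < pi, where
      \<open>near\<close> applies.\<close>
    define h where "h = min (d / 2) ((pi - p) / (2 * p))"
    have h: "0 < h" "h < d" using p d(1) by (auto simp: h_def)
    have "h * p \<le> (pi - p) / (2 * p) * p"
      using p by (intro mult_right_mono) (auto simp: h_def)
    also have "\<dots> < pi - p" using p by simp
    finally have "(1 + h) * p < pi" by (simp add: algebra_simps)
    moreover have "cmod (of_real (1 + h) * w) = (1 + h) * p"
      unfolding norm_mult norm_of_real w(1) using h by simp
    moreover have "p \<le> (1 + h) * p" using h p by (simp add: algebra_simps)
    ultimately have "cmod u \<le> cmod (exp (of_real (1 + h) * w) - c)"
      unfolding u_def by (intro near) simp_all
    then have "(cmod u)\<^sup>2 \<le> (cmod (exp (of_real (1 + h) * w) - c))\<^sup>2"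
      by (intro power_mono) simp_all
    with d(2)[OF h] show False by linarith
  qed
  define \<nu> where "\<nu> = inner (w * exp w) u / (cmod (w * exp w))\<^sup>2 * exp a"
  have \<nu>: "0 \<le> \<nu>" unfolding \<nu>_def using pos by simp
  have u: "u = of_real \<nu> * cis b * w"
  proof -
    define z where "z = w * exp w"
    have "z \<noteq> 0" using w(1) p by (auto simp: z_def)
    have "inner (\<i> * z) u = 0"
      using Im0 by (simp only: z_def mult.assoc)
    \<comment> \<open>As u is orthogonal to i z, it is a real multiple of z.\<close>
    then have "u * cnj z = of_real (inner z u)"
      by (simp add: complex_eq_iff inner_complex_def algebra_simps)
    then have "u * (z * cnj z) = of_real (inner z u) * z"
      by (simp add: mult_ac)
    then have "u * of_real ((cmod z)\<^sup>2) = of_real (inner z u) * z"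
      by (simp only: complex_norm_square)
    then have "u = of_real (inner z u / (cmod z)\<^sup>2) * z"
      using \<open>z \<noteq> 0\<close> by (simp add: field_simps)
    also have "\<dots> = of_real \<nu> * cis b * w"
      by (simp add: \<nu>_def z_def exp_w mult_ac)
    finally show ?thesis .
  qed
  have norm_u: "cmod u = \<nu> * p"
    using \<nu> w(1) by (simp add: u norm_mult)
  have "0 < \<nu>"
    using norm_u w(2) r \<nu> by (cases "\<nu> = 0") (auto simp: u_def)
  have "\<nu> \<le> K"
  proof (cases "a = 0")
    case False
    have "cmod (Complex (- a) b) = p"
      using w(1) by (simp add: ab cmod_def)
    then have "(cmod u)\<^sup>2 \<le> (cmod (exp (Complex (- a) b) - c))\<^sup>2"
      unfolding u_def using near[of "Complex (- a) b"] p by (intro power_mono) auto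
    also have "exp (Complex (- a) b) - c = exp (Complex (- a) b) - exp w + u"
      by (simp add: u_def)
    also have "\<dots> = cis b * Complex (\<nu> * a - 2 * sinh a) (\<nu> * b)"
      unfolding u exp_Complex exp_w ab by (simp add: complex_eq_iff sinh_def algebra_simps)
    also have "(cmod \<dots>)\<^sup>2 = (\<nu> * a - 2 * sinh a)\<^sup>2 + (\<nu> * b)\<^sup>2"
      by (simp add: norm_mult cmod_power2)
    finally have "\<nu>\<^sup>2 * (a\<^sup>2 + b\<^sup>2) \<le> (\<nu> * a - 2 * sinh a)\<^sup>2 + (\<nu> * b)\<^sup>2"
      by (simp add: norm_u power_mult_distrib ab_p)
    \<comment> \<open>Substitute sinh a = a K and cancel \<nu>^2 (a^2 + b^2).\<close>
    then have "0 \<le> 4 * (a\<^sup>2 * K) * (K - \<nu>)"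
      unfolding K_def sinhcsq_square[of a, symmetric] by (simp add: power2_eq_square algebra_simps)
    moreover have "0 < 4 * (a\<^sup>2 * K)"
      using False sinhcsq_pos[of a] by (simp add: K_def)
    ultimately show ?thesis by (simp add: zero_le_mult_iff)
  next
    case True
    have b: "b\<^sup>2 = p\<^sup>2" using ab_p True by simp
    have "c = exp w - u" by (simp add: u_def)
    then have c: "c = cis b * Complex 1 (- (\<nu> * b))"
      unfolding u ab True exp_Complex by (simp add: complex_eq_iff algebra_simps)
    \<comment> \<open>By \<open>norm_exp_diff\<close>, g has the sign of the gain in squared
      distance to c when P moves along the frontier to height b (1 - \<delta>). As g vanishes at 0,
      its derivative there cannot be negative.\<close>
    define g where "g \<delta> = coshsq (p\<^sup>2 - (b * (1 - \<delta>))\<^sup>2) - cos (b * \<delta>) - \<nu> * b * sin (b * \<delta>)" for \<delta>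
    have g: "0 \<le> g \<delta>" if \<delta>: "0 < \<delta>" "\<delta> < 1" for \<delta>
    proof -
      define a' where "a' = sqrt (p\<^sup>2 - (b * (1 - \<delta>))\<^sup>2)"
      have "(1 - \<delta>)\<^sup>2 \<le> 1" using \<delta> by (simp add: power_le_one)
      then have "(b * (1 - \<delta>))\<^sup>2 \<le> p\<^sup>2"
        by (simp add: power_mult_distrib b mult_left_le)
      then have a': "a'\<^sup>2 = p\<^sup>2 - (b * (1 - \<delta>))\<^sup>2" by (simp add: a'_def)
      then have "cmod (Complex a' (b * (1 - \<delta>))) = p"
        using p by (simp add: cmod_def)
      then have "(cmod u)\<^sup>2 \<le> (cmod (exp (Complex a' (b * (1 - \<delta>))) - c))\<^sup>2"
        unfolding u_def using near[of "Complex a' (b * (1 - \<delta>))"] p by (intro power_mono) auto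
      also have "\<dots> = (\<nu> * p)\<^sup>2 + 2 * exp a' * (cosh a'
          - (1 * cos (b * (1 - \<delta>) - b) + - (\<nu> * b) * sin (b * (1 - \<delta>) - b)))"
        unfolding c by (rule norm_exp_diff) (simp add: power_mult_distrib b)
      also have "b * (1 - \<delta>) - b = - (b * \<delta>)" by (simp add: algebra_simps)
      finally show ?thesis
        by (simp add: norm_u g_def zero_le_mult_iff a' [symmetric] coshsq_square)
    qed
    have deriv: "(g has_real_derivative (1 - \<nu>) * p\<^sup>2) (at 0)"
      unfolding g_def
      by (rule derivative_eq_intros DERIV_chain2[OF coshsq_has_derivative] refl | simp)+
        (simp add: b algebra_simps flip: power2_eq_square)
    have "\<nu> \<le> 1"
    proof (rule ccontr)
      assume "\<not> ?thesis"
      then have "(1 - \<nu>) * p\<^sup>2 < 0" using p by (simp add: mult_less_0_iff)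
      from DERIV_neg_dec_right[OF deriv this]
      obtain d where d: "0 < d" "\<And>h. 0 < h \<Longrightarrow> h < d \<Longrightarrow> g (0 + h) < g 0" by blast
      have "g 0 = 0" by (simp add: g_def b)
      moreover have "0 < min (d / 2) (1 / 2)" "min (d / 2) (1 / 2) < d" "min (d / 2) (1 / 2) < 1"
        using d(1) by linarith+
      ultimately show False
        using d(2)[of "min (d / 2) (1 / 2)"] g[of "min (d / 2) (1 / 2)"] by simp
    qed
    then show ?thesis by (simp add: K_def True)
  qed
  \<comment> \<open>Both centres lie on the normal at P, so their distance is (K - \<nu>) p; adding
    r \<le> \<nu> p gives at most the radius K p.\<close>
  have "disk_centre a b - c = of_real (\<nu> - K) * (cis b * w)"
    using exp_minus_disk_centre[of a b] u
    by (simp add: u_def K_def ab algebra_simps)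
  then have "cmod (disk_centre a b - c) = \<bar>\<nu> - K\<bar> * p"
    by (simp add: norm_mult w(1) del: of_real_diff)
  then have "dist (disk_centre a b) c + r \<le> disk_radius a b"
    using \<open>\<nu> \<le> K\<close> w(2) norm_u w(1)
    by (simp add: dist_norm disk_radius_def K_def u_def ab algebra_simps)
  then have "cball c r \<subseteq> cball (disk_centre a b) (disk_radius a b)"
    by (simp add: cball_subset_cball_iff dist_commute)
  with ab_p show ?thesis by (rule that)
qed

section \<open>The parametrization by the angle\<close>

lemma p_polar: "(p * cos t)\<^sup>2 + (p * sin t)\<^sup>2 = (p::real)\<^sup>2"
  by (simp add: power_mult_distrib flip: distrib_left)

lemma Complex_polar: "Complex (p * cos t) (p * sin t) = of_real p * cis t"
  by (simp add: complex_eq_iff)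

lemma norm_polar: "cmod (Complex (p * cos t) (p * sin t)) = \<bar>p\<bar>"
  by (simp add: Complex_polar norm_mult)

text \<open>Take t = arcsin(y / p), where cos t \<ge> 0; this is why |x| appears. The disks are
  unchanged under x -> -x.\<close>

lemma polar_half_circle:
  assumes "0 < p" "x\<^sup>2 + y\<^sup>2 = p\<^sup>2"
  shows "\<exists>t\<in>{-pi/2..pi/2}. \<bar>x\<bar> = p * cos t \<and> y = p * sin t"
proof -
  have "y\<^sup>2 \<le> p\<^sup>2" using assms(2) zero_le_power2[of x] by linarith
  then have y: "- 1 \<le> y / p" "y / p \<le> 1"
    using assms(1) by (simp_all add: abs_le_square_iff[symmetric] divide_simps)
  have "cos (arcsin (y / p)) = sqrt ((x / p)\<^sup>2)"
    using y assms by (simp add: cos_arcsin field_simps)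
  then have "\<bar>x\<bar> = p * cos (arcsin (y / p))"
    using assms(1) by simp
  with y assms(1) show ?thesis
    using arcsin_bounded[OF y] by (intro bexI[of _ "arcsin (y / p)"]) auto
qed

lemma disk_centre_minus: "disk_centre (- x) y = disk_centre x y"
  by (simp add: disk_centre_def)

lemma disk_radius_minus: "disk_radius (- x) y = disk_radius x y"
  by (simp add: disk_radius_def cmod_def)

lemma cos_pos_or_endpoint:
  assumes "t \<in> {-pi/2..pi/2}"
  shows "t = pi/2 \<or> t = - pi/2 \<or> t \<noteq> pi/2 \<and> t \<noteq> - pi/2 \<and> 0 < cos t"
  using assms cos_gt_zero_pi[of t] by fastforce

lemma Omega_eq:
  assumes "t \<in> {-pi/2..pi/2}"
  shows "Omega p t = disk_centre (p * cos t) (p * sin t)"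
  using cos_pos_or_endpoint[OF assms]
proof (elim disjE conjE)
  assume t: "t \<noteq> pi/2" "t \<noteq> - pi/2" "0 < cos t"
  have "Complex (cosh (p * cos t)) (- (p * sin t * sinhcsq ((p * cos t)\<^sup>2)))
      = of_real (cosh (p * cos t)) - \<i> * of_real (sinh (p * cos t) * sin t / cos t)"
    using t(3) by (simp add: complex_eq_iff flip: sinhcsq_square[of "p * cos t"])
  with t(1,2) show ?thesis
    by (simp add: Omega_def disk_centre_def cis_conv_exp)
qed (hypsubst, simp add: Omega_def disk_centre_def complex_eq_iff algebra_simps)+

lemma omega_eq:
  assumes "0 < p" "t \<in> {-pi/2..pi/2}"
  shows "omega p t = disk_radius (p * cos t) (p * sin t)"
  using cos_pos_or_endpoint[OF assms(2)]
proof (elim disjE conjE)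
  assume "t \<noteq> pi/2" "t \<noteq> - pi/2" "0 < cos t"
  with assms(1) show ?thesis
    by (simp add: omega_def disk_radius_def norm_polar flip: sinhcsq_square[of "p * cos t"])
qed (hypsubst, use assms(1) in \<open>simp add: omega_def disk_radius_def cmod_def\<close>)+

section \<open>Tangency and osculation along the boundary curve\<close>

lemma gamma_eq: "gamma p s = exp (of_real p * exp (\<i> * of_real s))"
  by (simp add: gamma_def Complex_polar cis_conv_exp)

lemma gamma_has_derivative:
  "(gamma p has_vector_derivative \<i> * of_real p * cis s * gamma p s) (at s)"
  unfolding gamma_eq[abs_def] cis_conv_exp
  by (rule has_vector_derivative_real_field[where f = "\<lambda>z. exp (of_real p * exp (\<i> * z))"])
    (auto intro!: derivative_eq_intros)

lemma vector_derivative_gamma: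
  "vector_derivative (gamma p) (at s) = \<i> * of_real p * cis s * gamma p s"
  by (rule vector_derivative_at[OF gamma_has_derivative])

lemma gamma_has_second_derivative:
  "((\<lambda>u. vector_derivative (gamma p) (at u)) has_vector_derivative
    - (of_real p * cis s * (1 + of_real p * cis s) * gamma p s)) (at s)"
  unfolding vector_derivative_gamma gamma_eq cis_conv_exp
  by (rule has_vector_derivative_real_field
      [where f = "\<lambda>z. \<i> * of_real p * exp (\<i> * z) * exp (of_real p * exp (\<i> * z))"])
    (auto intro!: derivative_eq_intros simp: algebra_simps)

text \<open>The velocity is i times a real multiple of the normal from
  \<open>exp_minus_disk_centre\<close>. Stated for every real s, it serves both contact parameters t
  and pi - t.\<close>

lemma tangent_gamma:
  assumes "0 < p"
  shows "circle_tangent_to_curve (disk_centre (p * cos s) (p * sin s))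
    (disk_radius (p * cos s) (p * sin s)) (gamma p) s"
proof -
  define k where "k = p * sinhcsq ((p * cos s)\<^sup>2)"
  have normal: "gamma p s - disk_centre (p * cos s) (p * sin s) = of_real k * cis (p * sin s) * cis s"
    unfolding gamma_def exp_minus_disk_centre by (simp add: Complex_polar k_def mult_ac)
  have g: "gamma p s = of_real (exp (p * cos s)) * cis (p * sin s)"
    by (simp add: gamma_def exp_Complex)
  have "gamma p s \<in> sphere (disk_centre (p * cos s) (p * sin s)) (disk_radius (p * cos s) (p * sin s))"
    unfolding mem_sphere dist_norm norm_minus_commute[of "disk_centre _ _"] normal
    using assms sinhcsq_pos[of "p * cos s"]
    by (simp add: norm_mult disk_radius_def norm_polar k_def)
  moreover have "inner (\<i> * of_real p * cis s * gamma p s) (of_real k * cis (p * sin s) * cis s) = 0"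
    unfolding g by (simp add: inner_complex_def algebra_simps)
  moreover have "\<i> * of_real p * cis s * gamma p s \<noteq> 0"
    using assms by (simp add: gamma_def)
  ultimately show ?thesis
    unfolding circle_tangent_to_curve_def normal using gamma_has_derivative by blast
qed

text \<open>With e = sin t = 1 or -1, both ends are treated at once: |d1| = p and Im(cnj d1 * d2) =
  p^2, so the curvature is 1/p and the centre is \<open>gamma p t\<close> + i d1.\<close>

lemma osculating_gamma:
  assumes "0 < p" "t \<in> {-pi/2, pi/2}"
  shows "osculating_disk (Omega p t) (omega p t) (gamma p) t"
proof -
  define e where "e = sin t"
  have t: "t = e * (pi / 2)" "cos t = 0" and e: "e = 1 \<or> e = - 1"
    using assms(2) unfolding e_def by (safe; simp)+
  have cis_t: "cis t = \<i> * of_real e"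
    using t by (simp add: complex_eq_iff e_def)
  have g: "gamma p t = cis (p * e)"
    using t by (simp add: gamma_def exp_Complex e_def)
  define d1 where "d1 = - (of_real (p * e) * cis (p * e))"
  define d2 where "d2 = of_real p * (of_real p - \<i> * of_real e) * cis (p * e)"
  have d1: "vector_derivative (gamma p) (at t) = d1"
    unfolding vector_derivative_gamma g cis_t d1_def by (simp add: mult_ac)
  have ee: "e * e = 1" using e by auto
  have "- (of_real p * cis t * (1 + of_real p * cis t) * gamma p t) = d2"
    unfolding g cis_t d2_def using e by (auto simp: algebra_simps)
  then have d2: "((\<lambda>u. vector_derivative (gamma p) (at u)) has_vector_derivative d2) (at t)"
    using gamma_has_second_derivative[of p t] by simp
  have norm_d1: "cmod d1 = p"
    using e assms(1) by (auto simp: d1_def norm_mult)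
  have "cnj d1 * d2 = - (of_real (p * e) * of_real p * (of_real p - \<i> * of_real e))
      * (cnj (cis (p * e)) * cis (p * e))"
    by (simp add: d1_def d2_def mult_ac)
  also have "cnj (cis (p * e)) * cis (p * e) = 1"
    by (simp add: cis_cnj cis_mult)
  finally have prod: "cnj d1 * d2 = - (of_real (p * e) * of_real p * (of_real p - \<i> * of_real e)) * 1" .
  have "Im (cnj d1 * d2) = p\<^sup>2 * (e * e)"
    unfolding prod by (simp add: power2_eq_square algebra_simps)
  then have \<kappa>: "1 / p = Im (cnj d1 * d2) / cmod d1 ^ 3"
    using assms(1) by (simp add: norm_d1 ee power2_eq_square power3_eq_cube)
  have t': "t \<in> {-pi/2..pi/2}" using assms(2) pi_gt_zero by (safe; simp)
  have centre: "Omega p t = gamma p t + \<i> * d1 / of_real (cmod d1) / of_real (1 / p)"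
    unfolding Omega_eq[OF t'] g norm_d1
    unfolding d1_def disk_centre_def t(2) e_def[symmetric] using assms(1)
    by (simp add: complex_eq_iff algebra_simps)
  have radius: "omega p t = 1 / \<bar>1 / p\<bar>"
    using assms by (auto simp: omega_def)
  have "d1 \<noteq> 0" using norm_d1 assms(1) by auto
  moreover have "\<forall>\<^sub>F u in nhds t. (gamma p has_vector_derivative vector_derivative (gamma p) (at u)) (at u)"
    unfolding vector_derivative_gamma by (intro always_eventually allI gamma_has_derivative)
  moreover have "1 / p \<noteq> 0" using assms(1) by simp
  ultimately show ?thesis
    unfolding osculating_disk_def using d1 d2 \<kappa> centre radius by blast
qed

section \<open>Orthogonality to the unit circle, chiral disks, and incomparability\<close>

lemma orthogonal_unit_circle:
  assumes "0 \<le> r" "(cmod c)\<^sup>2 = 1 + r\<^sup>2"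
  shows "orthogonal_circles c r 0 1"
  unfolding orthogonal_circles_def
proof (intro conjI ballI)
  have pos: "0 < 1 + r\<^sup>2" by (simp add: add_pos_nonneg)
  have norm: "cmod (Complex 1 r) = cmod c"
    using assms(2) by (simp add: cmod_def[of "Complex 1 r"] flip: assms(2))
  \<comment> \<open>The solution c / (1 - i r) of z - c = i r z: a right angle at z with legs 1 and
    r.\<close>
  define z where "z = c * Complex 1 r / of_real (1 + r\<^sup>2)"
  have "cmod z = (cmod c)\<^sup>2 / (1 + r\<^sup>2)"
    unfolding z_def norm_mult norm_divide norm norm_of_real using pos by (simp add: power2_eq_square)
  then have z: "cmod z = 1" using assms(2) pos by simp
  have "z - c = of_real r * \<i> * z"
  proof -
    have "of_real (1 + r\<^sup>2) * (z - c) = c * Complex 1 r - of_real (1 + r\<^sup>2) * c"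
      unfolding z_def using pos by (simp add: right_diff_distrib del: of_real_add of_real_power)
    also have "\<dots> = of_real r * \<i> * (c * Complex 1 r)"
      by (simp add: complex_eq_iff power2_eq_square algebra_simps)
    also have "c * Complex 1 r = of_real (1 + r\<^sup>2) * z"
      unfolding z_def using pos by (simp del: of_real_add of_real_power)
    finally have "of_real (1 + r\<^sup>2) * (z - c) = of_real (1 + r\<^sup>2) * (of_real r * \<i> * z)"
      by (simp only: mult_ac)
    then show ?thesis
      using pos by (simp del: of_real_add of_real_power)
  qed
  then have "cmod (z - c) = r"
    using z assms(1) by (simp add: norm_mult)
  then have "z \<in> sphere c r \<inter> sphere 0 1"
    using z by (simp add: dist_norm norm_minus_commute)
  then show "sphere c r \<inter> sphere 0 1 \<noteq> {}" by blast
next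
  fix z assume "z \<in> sphere c r \<inter> sphere 0 1"
  then have z: "(norm (z - c))\<^sup>2 = r\<^sup>2" "(norm z)\<^sup>2 = 1"
    by (auto simp: dist_norm norm_minus_commute)
  have "(norm c)\<^sup>2 = (norm (z - c))\<^sup>2 + (norm z)\<^sup>2 - 2 * inner (z - c) z"
    by (simp add: power2_norm_eq_inner inner_diff_left inner_diff_right inner_commute)
  with z assms(2) show "inner (z - c) (z - 0) = 0" by simp
qed

text \<open>Left multiplication by cos y Id + sin y \<open>Itil\<close> rotates the (Id, I)-plane
  and the (J, K)-plane by y. The first rotation gives the factor \<open>cis y\<close> of the centre,
  the second preserves the radius.\<close>

lemma CD_W:
  assumes "x\<^sup>2 + y\<^sup>2 = p\<^sup>2"
  shows "CD (W p y) = cball (disk_centre x y) (disk_radius x y)"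
proof -
  define K where "K = sinhcsq (x\<^sup>2)"
  have x: "p\<^sup>2 - y\<^sup>2 = x\<^sup>2" using assms by simp
  have W: "W p y = (cosh x * cos y + y * K * sin y) *\<^sub>R mat 1 + (cosh x * sin y - y * K * cos y) *\<^sub>R Itil
      + (- (p * K * sin y)) *\<^sub>R Jtil + (p * K * cos y) *\<^sub>R Ktil"
    unfolding W_def mexp_Itil mexp_Itil_Ktil x coshsq_square K_def
    by (simp add: tilde_matrix_simps) (simp add: algebra_simps)
  have "(- (p * K * sin y))\<^sup>2 + (p * K * cos y)\<^sup>2 = (p * K)\<^sup>2 * ((sin y)\<^sup>2 + (cos y)\<^sup>2)"
    by (simp only: power2_minus power_mult_distrib distrib_left)
  also have "\<dots> = (disk_radius x y)\<^sup>2"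
    by (simp add: disk_radius_def power_mult_distrib cmod_power2 assms K_def)
  finally have "sqrt ((- (p * K * sin y))\<^sup>2 + (p * K * cos y)\<^sup>2) = disk_radius x y"
    by (simp add: disk_radius_nonneg)
  moreover have "Complex (cosh x * cos y + y * K * sin y) (cosh x * sin y - y * K * cos y) = disk_centre x y"
    by (simp add: disk_centre_def K_def complex_eq_iff algebra_simps)
  ultimately show ?thesis
    unfolding W CD_eq by simp
qed

text \<open>A contact point of the inner disk is also one of the outer disk; injectivity of exp then
  gives sin s = sin t. This yields distinctness as well as maximality.\<close>

lemma disk_subset_imp_eq:
  assumes p: "0 < p" "p < pi" and st: "s \<in> {-pi/2..pi/2}" "t \<in> {-pi/2..pi/2}"
    and sub: "cball (Omega p s) (omega p s) \<subseteq> cball (Omega p t) (omega p t)"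
  shows "s = t"
proof -
  have "exp (Complex (p * cos s) (p * sin s))
      \<in> cball (Omega p s) (omega p s) \<inter> frontier (expD p)"
    unfolding Omega_eq[OF st(1)] omega_eq[OF p(1) st(1)] disk_Int_frontier[OF p_polar p]
    by (rule insertI1)
  also have "\<dots> \<subseteq> cball (Omega p t) (omega p t) \<inter> frontier (expD p)"
    using sub by (rule Int_mono) (rule order_refl)
  finally have "exp (Complex (p * cos s) (p * sin s))
      \<in> {exp (Complex (p * cos t) (p * sin t)), exp (Complex (- (p * cos t)) (p * sin t))}"
    unfolding Omega_eq[OF st(2)] omega_eq[OF p(1) st(2)] disk_Int_frontier[OF p_polar p] .
  moreover have "cmod (Complex (- (p * cos t)) (p * sin t)) = cmod (Complex (p * cos t) (p * sin t))"
    by (simp add: cmod_def)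
  ultimately obtain x where x: "exp (Complex (p * cos s) (p * sin s)) = exp (Complex x (p * sin t))"
    "cmod (Complex x (p * sin t)) = p"
    using norm_polar[of p t] p(1) unfolding insert_iff by (metis abs_of_pos empty_iff)
  have "Complex (p * cos s) (p * sin s) = Complex x (p * sin t)"
    using x(2) p norm_polar[of p s] by - (rule inj_onD[OF inj_on_exp_pi[of 0] x(1)], simp_all)
  then have "sin s = sin t" using p by simp
  then show ?thesis
    using st by (metis atLeastAtMost_iff minus_divide_left sin_inj_pi)
qed

theorem theorem11p1:
  fixes p :: real
  assumes "0 < p" and "p < pi"
  shows
   "(\<forall>t \<in> {-pi/2..pi/2}.
        circle_tangent_to_curve (Omega p t) (omega p t) (gamma p) t \<and>
        circle_tangent_to_curve (Omega p t) (omega p t) (gamma p) (pi - t) \<and>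
        gamma p t = exp (Complex (p * cos t) (p * sin t)) \<and>
        gamma p (pi - t) = exp (Complex (- p * cos t) (p * sin t)) \<and>
        gamma p (pi - t) = 1 / cnj (gamma p t) \<and>
        orthogonal_circles (Omega p t) (omega p t) 0 1)
    \<and> (\<forall>t \<in> {-pi/2, pi/2}. osculating_disk (Omega p t) (omega p t) (gamma p) t)
    \<and> (\<forall>s \<in> {-pi/2..pi/2}. \<forall>t \<in> {-pi/2..pi/2}. s \<noteq> t \<longrightarrow>
          cball (Omega p s) (omega p s) \<noteq> cball (Omega p t) (omega p t))
    \<and> (\<forall>t \<in> {-pi/2..pi/2}. CD (W p (p * sin t)) = cball (Omega p t) (omega p t))
    \<and> {D. maximal_disk_in (expD p) D} = (\<lambda>t. cball (Omega p t) (omega p t)) ` {-pi/2..pi/2}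
    \<and> (\<forall>t \<in> {-pi/2..pi/2}. cball (Omega p t) (omega p t) \<inter> frontier (expD p) =
          {exp (Complex (p * cos t) (p * sin t)), exp (Complex (- p * cos t) (p * sin t))})"
proof (intro conjI ballI impI)
  fix t assume t: "t \<in> {-pi/2..pi/2}"
  note eq = Omega_eq[OF t] omega_eq[OF assms(1) t]
  show "circle_tangent_to_curve (Omega p t) (omega p t) (gamma p) t"
    unfolding eq by (rule tangent_gamma[OF assms(1)])
  show "circle_tangent_to_curve (Omega p t) (omega p t) (gamma p) (pi - t)"
    using tangent_gamma[OF assms(1), of "pi - t"] unfolding eq
    by (simp add: disk_centre_minus disk_radius_minus)
  show "gamma p t = exp (Complex (p * cos t) (p * sin t))"
    by (simp add: gamma_def)
  show "gamma p (pi - t) = exp (Complex (- p * cos t) (p * sin t))"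
    by (simp add: gamma_def)
  show "gamma p (pi - t) = 1 / cnj (gamma p t)"
    by (simp add: gamma_def exp_Complex cis_cnj exp_minus cis_inverse[symmetric] field_simps
        flip: of_real_inverse)
  show "orthogonal_circles (Omega p t) (omega p t) 0 1"
    unfolding eq by (intro orthogonal_unit_circle disk_radius_nonneg norm_disk_centre)
  show "CD (W p (p * sin t)) = cball (Omega p t) (omega p t)"
    unfolding eq by (rule CD_W) (simp add: p_polar)
  show "cball (Omega p t) (omega p t) \<inter> frontier (expD p) =
      {exp (Complex (p * cos t) (p * sin t)), exp (Complex (- p * cos t) (p * sin t))}"
    unfolding eq using disk_Int_frontier[OF p_polar assms] by simp
next
  fix t assume "t \<in> {-pi/2, pi/2}"
  then show "osculating_disk (Omega p t) (omega p t) (gamma p) t"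
    by (rule osculating_gamma[OF assms(1)])
next
  fix s t assume "s \<in> {-pi/2..pi/2}" "t \<in> {-pi/2..pi/2}" "s \<noteq> t"
  then show "cball (Omega p s) (omega p s) \<noteq> cball (Omega p t) (omega p t)"
    using disk_subset_imp_eq[OF assms, of s t] by blast
next
  let ?D = "\<lambda>t. cball (Omega p t) (omega p t)"
  have disk: "?D t \<in> closed_disks" "?D t \<subseteq> expD p" if t: "t \<in> {-pi/2..pi/2}" for t
  proof -
    show "?D t \<subseteq> expD p"
      unfolding Omega_eq[OF t] omega_eq[OF assms(1) t] by (rule disk_subset_expD[OF p_polar assms])
    have "0 < omega p t"
      unfolding omega_eq[OF assms(1) t] disk_radius_def norm_polar using assms sinhcsq_pos by simp
    then show "?D t \<in> closed_disks"
      by (auto simp: closed_disks_def)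
  qed
  \<comment> \<open>Every disk in the set lies in a member of the family; with incomparability this
    gives both inclusions below.\<close>
  have sub: "\<exists>t\<in>{-pi/2..pi/2}. D \<subseteq> ?D t" if D: "D \<in> closed_disks" "D \<subseteq> expD p" for D
  proof -
    obtain c r where cr: "D = cball c r" "0 < r" using D(1) by (auto simp: closed_disks_def)
    obtain x y where xy: "x\<^sup>2 + y\<^sup>2 = p\<^sup>2" and Dxy: "D \<subseteq> cball (disk_centre x y) (disk_radius x y)"
      using disk_subset_tangent_disk[OF assms] D(2) cr by metis
    obtain t where t: "t \<in> {-pi/2..pi/2}" "\<bar>x\<bar> = p * cos t" "y = p * sin t"
      using polar_half_circle[OF assms(1) xy] by blast
    have "cball (disk_centre x y) (disk_radius x y) = ?D t"
      unfolding Omega_eq[OF t(1)] omega_eq[OF assms(1) t(1)] t(2,3)[symmetric]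
      by (simp add: abs_if disk_centre_minus disk_radius_minus)
    with Dxy t(1) show ?thesis by auto
  qed
  show "{D. maximal_disk_in (expD p) D} = ?D ` {-pi/2..pi/2}"
  proof (intro equalityI subsetI)
    fix D assume "D \<in> {D. maximal_disk_in (expD p) D}"
    then have D: "D \<in> closed_disks" "D \<subseteq> expD p"
      "\<And>D'. D' \<in> closed_disks \<Longrightarrow> D \<subseteq> D' \<Longrightarrow> D' \<subseteq> expD p \<Longrightarrow> D' = D"
      by (auto simp: maximal_disk_in_def)
    obtain t where "t \<in> {-pi/2..pi/2}" "D \<subseteq> ?D t" using sub[OF D(1,2)] by blast
    with D(3)[OF disk(1)] disk(2) show "D \<in> ?D ` {-pi/2..pi/2}" by blast
  next
    fix D assume "D \<in> ?D ` {-pi/2..pi/2}"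
    then obtain t where t: "t \<in> {-pi/2..pi/2}" "D = ?D t" by blast
    \<comment> \<open>D' is squeezed between ?D t and some ?D s, and incomparability forces s =
      t.\<close>
    have "D' = D" if D': "D' \<in> closed_disks" "D \<subseteq> D'" "D' \<subseteq> expD p" for D'
    proof -
      obtain s where s: "s \<in> {-pi/2..pi/2}" "D' \<subseteq> ?D s" using sub[OF D'(1,3)] by blast
      then have "t = s"
        using disk_subset_imp_eq[OF assms t(1) s(1)] D'(2) t(2) by blast
      with s D' t show ?thesis by blast
    qed
    with disk[OF t(1)] t(2) show "D \<in> {D. maximal_disk_in (expD p) D}"
      unfolding maximal_disk_in_def by blast
  qed
qed

end
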